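(* Let $\{X_t\}_{t\ge 0}$ be a stationary stochastic process with values in a finite set $\{\beta_0,\ldots,\beta_{L-1}\}$ and with memory $m\ge 1$. Let $\mathcal{H}(r)$ be the straight line (affine function of $r$) that fulfills $\mathcal{H}(r)=H_r$ for all integers $r\ge m$. Then $\mathcal{G}_{m-1}$ equals the Euclidean distance in the $(r,H_r)$ plane between $H_r$ and $\mathcal{H}(r)$ at $r=m-1$, i.e. the distance between the points $(m-1,H_{m-1})$ and $(m-1,\mathcal{H}(m-1))$: $$\mathcal{G}_{m-1}=\bigl|\mathcal{H}(m-1)-H_{m-1}\bigr|.$$
   Context: For $r\ge1$, $p(\beta_{i_1},\ldots,\beta_{i_r})$ denotes the probability that $r$ consecutive values of the process are $\beta_{i_1},\ldots,\beta_{i_r}$ in temporal order (independent of the starting time by stationarity), and $p(\beta_j|\beta_{i_1},\ldots,\beta_{i_r})$ is the conditional probability that the next value is $\beta_j$ given that the previous $r$ values were $\beta_{i_1},\ldots,\beta_{i_r}$ (for blocks of positive probability). The block entropy of size $r\ge 1$ is $H_r=-\sum_{i_1,\ldots,i_r=0}^{L-1}p(\beta_{i_1},\ldots,\beta_{i_r})\ln p(\beta_{i_1},\ldots,\beta_{i_r})$ (with $0\ln 0=0$), and $H_0=0$. The predictability gain is, for integer $u\ge 0$, $$\mathcal{G}_u=-(H_{u+2}-2H_{u+1}+H_u).$$ The process has memory $m\ge 1$ if $m$ is the minimal value such that for all $u\ge m$ and all blocks of positive probability $$p(\beta_{i_{u+1}}|\beta_{i_1},\ldots,\beta_{i_u})=p(\beta_{i_{u+1}}|\beta_{i_{u-m+1}},\ldots,\beta_{i_u});$$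 memory $0$ means that the $X_t$ are independent and identically distributed. It is a known fact (from earlier literature) that a process of memory $m$ has $H_r$ an affine function of $r$ for $r\ge m$, so that the line $\mathcal{H}$ exists; it is unique. *)

theory Defs
  imports "HOL-Probability.Probability"
begin

definition stationary :: "'w measure \<Rightarrow> 'b set \<Rightarrow> (nat \<Rightarrow> 'w \<Rightarrow> 'b) \<Rightarrow> bool" where
  "stationary M S X \<longleftrightarrow>
     (\<forall>J h. finite J \<longrightarrow>
        distr M (\<Pi>\<^sub>M t\<in>J. count_space S) (\<lambda>\<omega>. \<lambda>t\<in>J. X (t + h) \<omega>) =
        distr M (\<Pi>\<^sub>M t\<in>J. count_space S) (\<lambda>\<omega>. \<lambda>t\<in>J. X t \<omega>))"

definition blocks :: "'b set \<Rightarrow> nat \<Rightarrow> 'b list set" where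
  "blocks S r = {xs. set xs \<subseteq> S \<and> length xs = r}"

text \<open>Block probabilities are read off at starting time 0. For a stationary process any other
  starting time gives the same value.\<close>

definition block_prob :: "'w measure \<Rightarrow> (nat \<Rightarrow> 'w \<Rightarrow> 'b) \<Rightarrow> 'b list \<Rightarrow> real" where
  "block_prob M X xs = \<P>(\<omega> in M. \<forall>i<length xs. X i \<omega> = xs ! i)"

definition next_prob :: "'w measure \<Rightarrow> (nat \<Rightarrow> 'w \<Rightarrow> 'b) \<Rightarrow> 'b \<Rightarrow> 'b list \<Rightarrow> real" where
  "next_prob M X b xs =
     \<P>(\<omega> in M. X (length xs) \<omega> = b \<bar> \<forall>i<length xs. X i \<omega> = xs ! i)"

text \<open>The convention \<open>0 ln 0 = 0\<close> holds automatically, since \<open>0 * x = 0\<close>.\<close>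

definition block_entropy :: "'w measure \<Rightarrow> 'b set \<Rightarrow> (nat \<Rightarrow> 'w \<Rightarrow> 'b) \<Rightarrow> nat \<Rightarrow> real" where
  "block_entropy M S X r =
     (if r = 0 then 0
      else - (\<Sum>xs\<in>blocks S r. block_prob M X xs * ln (block_prob M X xs)))"

definition predictability_gain :: "'w measure \<Rightarrow> 'b set \<Rightarrow> (nat \<Rightarrow> 'w \<Rightarrow> 'b) \<Rightarrow> nat \<Rightarrow> real" where
  "predictability_gain M S X u =
     - (block_entropy M S X (u + 2) - 2 * block_entropy M S X (u + 1) + block_entropy M S X u)"

definition iid :: "'w measure \<Rightarrow> 'b set \<Rightarrow> (nat \<Rightarrow> 'w \<Rightarrow> 'b) \<Rightarrow> bool" where
  "iid M S X \<longleftrightarrow>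
     prob_space.indep_vars M (\<lambda>_. count_space S) X UNIV \<and>
     (\<forall>t. distr M (count_space S) (X t) = distr M (count_space S) (X 0))"

text \<open>The block \<open>drop (u - m) xs\<close> consists of the last \<open>m\<close> entries of a block \<open>xs\<close>
  of length \<open>u\<close>.\<close>

definition depends_on_last :: "'w measure \<Rightarrow> 'b set \<Rightarrow> (nat \<Rightarrow> 'w \<Rightarrow> 'b) \<Rightarrow> nat \<Rightarrow> bool" where
  "depends_on_last M S X m \<longleftrightarrow>
     (if m = 0 then iid M S X
      else \<forall>u\<ge>m. \<forall>xs\<in>blocks S u. \<forall>b\<in>S. block_prob M X xs > 0 \<longrightarrow>
             next_prob M X b xs = next_prob M X b (drop (u - m) xs))"

text \<open>Minimality ranges over \<open>k = 0\<close> as well, so an i.i.d. process has memory 0 and not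
  memory 1.\<close>

definition has_memory :: "'w measure \<Rightarrow> 'b set \<Rightarrow> (nat \<Rightarrow> 'w \<Rightarrow> 'b) \<Rightarrow> nat \<Rightarrow> bool" where
  "has_memory M S X m \<longleftrightarrow>
     depends_on_last M S X m \<and> (\<forall>k<m. \<not> depends_on_last M S X k)"

text \<open>For a stationary process with memory \<open>m\<close> there is exactly one such line; a statement
  about this constant therefore includes its existence.\<close>

definition entropy_line :: "'w measure \<Rightarrow> 'b set \<Rightarrow> (nat \<Rightarrow> 'w \<Rightarrow> 'b) \<Rightarrow> nat \<Rightarrow> real \<Rightarrow> real" where
  "entropy_line M S X m =
     (THE h. (\<exists>a b. \<forall>x. h x = a * x + b) \<and> (\<forall>r\<ge>m. h (real r) = block_entropy M S X r))"

end

theory Submission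
  imports Defs
begin

text \<open>
  The gain \<open>G\<^sub>u\<close> is the conditional mutual information, given the \<open>u\<close> values in between, of the
  first and the last of \<open>u + 2\<close> consecutive values. Hence it is nonnegative by \<open>ln x \<le> x - 1\<close>, and it
  vanishes for \<open>u \<ge> m\<close>, where the first value does not influence the last one. So the second
  differences of the block entropy are \<open>0\<close> from \<open>m\<close> on, the line is
  \<open>x \<mapsto> H\<^sub>m + (x - m) (H\<^sub>m\<^sub>+\<^sub>1 - H\<^sub>m)\<close>, and its value at \<open>m - 1\<close> exceeds \<open>H\<^sub>m\<^sub>-\<^sub>1\<close> by exactly \<open>G\<^sub>m\<^sub>-\<^sub>1\<close>.
\<close>

section \<open>Summation over blocks, splitting off the first or the last letter\<close>

lemma blocks_0: "blocks S 0 = {[]}"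
  by (auto simp: blocks_def)

lemma sum_blocks_Cons: "(\<Sum>xs\<in>blocks S (Suc r). f xs) = (\<Sum>xs\<in>blocks S r. \<Sum>a\<in>S. f (a # xs))"
proof -
  have "(\<Sum>xs\<in>blocks S (Suc r). f xs) = (\<Sum>(xs, a)\<in>blocks S r \<times> S. f (a # xs))"
    by (rule sum.reindex_bij_witness[of _ "\<lambda>(xs, a). a # xs" "\<lambda>xs. (tl xs, hd xs)"])
       (auto simp: blocks_def length_Suc_conv)
  then show ?thesis
    by (simp add: sum.cartesian_product)
qed

lemma sum_blocks_snoc: "(\<Sum>xs\<in>blocks S (Suc r). f xs) = (\<Sum>xs\<in>blocks S r. \<Sum>b\<in>S. f (xs @ [b]))"
proof -
  have "(\<Sum>xs\<in>blocks S (Suc r). f xs) = (\<Sum>(xs, b)\<in>blocks S r \<times> S. f (xs @ [b]))"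
    by (rule sum.reindex_bij_witness[of _ "\<lambda>(xs, b). xs @ [b]" "\<lambda>xs. (butlast xs, last xs)"])
       (auto simp: blocks_def length_Suc_conv_rev)
  then show ?thesis
    by (simp add: sum.cartesian_product)
qed

section \<open>Block probabilities and their marginals\<close>

locale stationary_process = prob_space M
  for M :: "'w measure" and S :: "'b set" and X :: "nat \<Rightarrow> 'w \<Rightarrow> 'b" +
  assumes finite_S: "finite S"
    and measurable_X [measurable]: "\<And>t. X t \<in> measurable M (count_space S)"
    and stationary: "stationary M S X"
begin

abbreviation p :: "'b list \<Rightarrow> real" where "p \<equiv> block_prob M X"

abbreviation H :: "nat \<Rightarrow> real" where "H \<equiv> block_entropy M S X"

lemma X_in_S: "\<omega> \<in> space M \<Longrightarrow> X t \<omega> \<in> S"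
  using measurable_space[OF measurable_X, of \<omega> t] by simp

lemma sets_X_eq: "{\<omega>\<in>space M. X t \<omega> = b} \<in> events"
proof -
  \<comment> \<open>The letter \<open>b\<close> may lie outside \<open>S\<close>, so
    \<open>{b}\<close> is cut down to a measurable set of \<open>count_space S\<close>.\<close>
  have "{\<omega>\<in>space M. X t \<omega> = b} = X t -` ({b} \<inter> S) \<inter> space M"
    using X_in_S by auto
  also have "\<dots> \<in> events"
    by (rule measurable_sets[OF measurable_X]) simp
  finally show ?thesis .
qed

lemma sets_block: "{\<omega>\<in>space M. \<forall>i<n. X (i + h) \<omega> = xs ! i} \<in> events"
proof (induction n)
  case (Suc n)
  have "{\<omega>\<in>space M. \<forall>i<Suc n. X (i + h) \<omega> = xs ! i} =
      {\<omega>\<in>space M. \<forall>i<n. X (i + h) \<omega> = xs ! i} \<inter> {\<omega>\<in>space M. X (n + h) \<omega> = xs ! n}"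
    by (auto simp: less_Suc_eq)
  then show ?case
    by (simp only:) (intro sets.Int Suc.IH sets_X_eq)
qed simp

lemma p_nonneg: "0 \<le> p xs"
  by (simp add: block_prob_def)

lemma p_Nil: "p [] = 1"
  by (simp add: block_prob_def prob_space)

text \<open>The block event is the preimage of the one-point box \<open>A\<close> under a finite
  tuple of the process, and stationarity says that the law of this tuple does not depend on the
  shift.\<close>

lemma p_shift:
  assumes "xs \<in> blocks S r"
  shows "prob {\<omega>\<in>space M. \<forall>i<r. X (i + h) \<omega> = xs ! i} = p xs"
proof -
  define J where "J = {..<r}"
  let ?P = "\<Pi>\<^sub>M t\<in>J. count_space S"
  define A where "A = (\<Pi>\<^sub>E i\<in>J. {xs ! i})"
  have sub: "\<And>i. i \<in> J \<Longrightarrow> xs ! i \<in> S"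
    using assms by (auto simp: J_def blocks_def)
  have A: "A \<in> sets ?P"
    unfolding A_def by (rule sets_PiM_I_finite) (use sub in \<open>auto simp: J_def\<close>)
  have *: "measure (distr M ?P (\<lambda>\<omega>. \<lambda>t\<in>J. X (t + k) \<omega>)) A
      = prob {\<omega>\<in>space M. \<forall>i<r. X (i + k) \<omega> = xs ! i}" for k
  proof -
    have "(\<lambda>\<omega>. \<lambda>t\<in>J. X (t + k) \<omega>) -` A \<inter> space M = {\<omega>\<in>space M. \<forall>i<r. X (i + k) \<omega> = xs ! i}"
      unfolding A_def J_def by (simp add: vimage_def PiE_iff Int_def conj_commute Ball_def)
    then show ?thesis
      by (subst measure_distr[OF _ A]) (intro measurable_restrict measurable_X, simp)
  qed
  have "prob {\<omega>\<in>space M. \<forall>i<r. X (i + h) \<omega> = xs ! i}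
      = measure (distr M ?P (\<lambda>\<omega>. \<lambda>t\<in>J. X (t + h) \<omega>)) A"
    by (rule *[symmetric])
  also have "distr M ?P (\<lambda>\<omega>. \<lambda>t\<in>J. X (t + h) \<omega>) = distr M ?P (\<lambda>\<omega>. \<lambda>t\<in>J. X (t + 0) \<omega>)"
    using stationary[unfolded stationary_def, rule_format, of J h]
    by (simp only: J_def finite_lessThan add_0_right)
  also have "measure \<dots> A = p xs"
    using assms by (subst *) (simp add: block_prob_def blocks_def)
  finally show ?thesis .
qed

lemma prob_sum_value:
  assumes "E \<in> events"
  shows "(\<Sum>b\<in>S. prob {\<omega>\<in>E. X t \<omega> = b}) = prob E"
proof -
  have eq: "{\<omega>\<in>E. X t \<omega> = b} = E \<inter> {\<omega>\<in>space M. X t \<omega> = b}" for b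
    using sets.sets_into_space[OF assms] by auto
  have "prob (\<Union>b\<in>S. {\<omega>\<in>E. X t \<omega> = b}) = (\<Sum>b\<in>S. prob {\<omega>\<in>E. X t \<omega> = b})"
    using assms by (intro finite_measure_finite_Union)
      (auto simp: finite_S eq sets_X_eq disjoint_family_on_def intro!: sets.Int)
  moreover have "(\<Union>b\<in>S. {\<omega>\<in>E. X t \<omega> = b}) = E"
    using sets.sets_into_space[OF assms] X_in_S by auto
  ultimately show ?thesis by simp
qed

lemma snoc_event:
  assumes "length xs = r"
  shows "(\<forall>i<Suc r. X i \<omega> = (xs @ [b]) ! i) \<longleftrightarrow> (\<forall>i<r. X i \<omega> = xs ! i) \<and> X r \<omega> = b"
  using assms by (auto simp: less_Suc_eq nth_append)

lemma sum_p_snoc: "(\<Sum>b\<in>S. p (xs @ [b])) = p xs"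
proof -
  define E where "E = {\<omega>\<in>space M. \<forall>i<length xs. X i \<omega> = xs ! i}"
  have "p (xs @ [b]) = prob {\<omega>\<in>E. X (length xs) \<omega> = b}" for b
    by (simp add: block_prob_def snoc_event[OF refl] E_def conj_ac)
  moreover have "E \<in> events"
    using sets_block[of "length xs" 0 xs] by (simp add: E_def)
  ultimately show ?thesis
    by (simp add: prob_sum_value) (simp add: block_prob_def E_def)
qed

text \<open>Summing out the first letter leaves a block that starts at time 1, so unlike
  \<open>sum_p_snoc\<close> this needs stationarity, through \<open>p_shift\<close>.\<close>

lemma sum_p_Cons:
  assumes "xs \<in> blocks S r"
  shows "(\<Sum>a\<in>S. p (a # xs)) = p xs"
proof -
  define E where "E = {\<omega>\<in>space M. \<forall>i<r. X (i + 1) \<omega> = xs ! i}"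
  have len: "length xs = r"
    using assms by (simp add: blocks_def)
  have "p (a # xs) = prob {\<omega>\<in>E. X 0 \<omega> = a}" for a
    by (simp add: block_prob_def len E_def All_less_Suc2 conj_ac)
  moreover have "E \<in> events"
    unfolding E_def by (rule sets_block)
  ultimately have "(\<Sum>a\<in>S. p (a # xs)) = prob E"
    by (simp add: prob_sum_value)
  then show ?thesis
    using p_shift[OF assms, of 1] by (simp add: E_def)
qed

lemma p_snoc_le: "b \<in> S \<Longrightarrow> p (xs @ [b]) \<le> p xs"
  using member_le_sum[of b S "\<lambda>b. p (xs @ [b])"] by (simp add: sum_p_snoc finite_S p_nonneg)

lemma p_Cons_le: "xs \<in> blocks S r \<Longrightarrow> a \<in> S \<Longrightarrow> p (a # xs) \<le> p xs"
  using member_le_sum[of a S "\<lambda>a. p (a # xs)"] by (simp add: sum_p_Cons finite_S p_nonneg)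

section \<open>Entropy and predictability gain in terms of block probabilities\<close>

lemma next_prob_eq: "next_prob M X b xs = p (xs @ [b]) / p xs"
  by (simp add: next_prob_def cond_prob_def block_prob_def snoc_event[OF refl] conj_ac)

text \<open>The empty block has probability 1 and \<open>ln 1 = 0\<close>, so the size 0 needs no
  separate treatment below.\<close>

lemma block_entropy_eq: "H r = - (\<Sum>xs\<in>blocks S r. p xs * ln (p xs))"
  by (simp add: block_entropy_def blocks_0 p_Nil)

lemma Cons_blocks: "xs \<in> blocks S r \<Longrightarrow> a \<in> S \<Longrightarrow> a # xs \<in> blocks S (Suc r)"
  by (simp add: blocks_def)

lemma snoc_blocks: "xs \<in> blocks S r \<Longrightarrow> b \<in> S \<Longrightarrow> xs @ [b] \<in> blocks S (Suc r)"
  by (auto simp: blocks_def)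

text \<open>Marginals dominate the joint probability. This makes every factor inside the logarithms
  below positive.\<close>

lemma positive_sub_blocks:
  assumes "xs \<in> blocks S r" "a \<in> S" "b \<in> S" "p (a # xs @ [b]) > 0"
  shows "p (a # xs) > 0" "p (xs @ [b]) > 0" "p xs > 0"
proof -
  show "p (a # xs) > 0"
    using p_snoc_le[of b "a # xs"] assms by simp
  show "p (xs @ [b]) > 0"
    using p_Cons_le[of "xs @ [b]" "Suc r" a] assms by (simp add: snoc_blocks)
  then show "p xs > 0"
    using p_snoc_le[of b xs] assms by simp
qed

text \<open>The logarithm splits into four terms; in each, the letters absent from the logarithm are
  summed out, which leaves block entropies of sizes \<open>r + 2\<close>, \<open>r\<close> and twice
  \<open>r + 1\<close>.\<close>

lemma gain_eq_mutual_information: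
  "predictability_gain M S X r =
     (\<Sum>xs\<in>blocks S r. \<Sum>a\<in>S. \<Sum>b\<in>S.
        p (a # xs @ [b]) * ln (p (a # xs @ [b]) * p xs / (p (a # xs) * p (xs @ [b]))))"
    (is "_ = ?D")
proof -
  let ?l = "\<lambda>xs. ln (p xs)"
  have "?D = (\<Sum>xs\<in>blocks S r. \<Sum>a\<in>S. \<Sum>b\<in>S.
      p (a # xs @ [b]) * ?l (a # xs @ [b]) + p (a # xs @ [b]) * ?l xs
      - p (a # xs @ [b]) * ?l (a # xs) - p (a # xs @ [b]) * ?l (xs @ [b]))"
  proof (intro sum.cong refl)
    fix xs a b assume *: "xs \<in> blocks S r" "a \<in> S" "b \<in> S"
    show "p (a # xs @ [b]) * ln (p (a # xs @ [b]) * p xs / (p (a # xs) * p (xs @ [b]))) =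
      p (a # xs @ [b]) * ?l (a # xs @ [b]) + p (a # xs @ [b]) * ?l xs
      - p (a # xs @ [b]) * ?l (a # xs) - p (a # xs @ [b]) * ?l (xs @ [b])"
    proof (cases "p (a # xs @ [b]) = 0")
      case False
      then have "p (a # xs @ [b]) > 0"
        using p_nonneg[of "a # xs @ [b]"] by simp
      with positive_sub_blocks[OF * this] show ?thesis
        by (simp add: ln_mult ln_div algebra_simps)
    qed simp
  qed
  also have "\<dots> = (\<Sum>xs\<in>blocks S r. \<Sum>a\<in>S. \<Sum>b\<in>S. p (a # xs @ [b]) * ?l (a # xs @ [b]))
      + (\<Sum>xs\<in>blocks S r. \<Sum>a\<in>S. \<Sum>b\<in>S. p (a # xs @ [b]) * ?l xs)
      - (\<Sum>xs\<in>blocks S r. \<Sum>a\<in>S. \<Sum>b\<in>S. p (a # xs @ [b]) * ?l (a # xs))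
      - (\<Sum>xs\<in>blocks S r. \<Sum>a\<in>S. \<Sum>b\<in>S. p (a # xs @ [b]) * ?l (xs @ [b]))"
    by (simp only: sum.distrib sum_subtractf)
  also have "(\<Sum>xs\<in>blocks S r. \<Sum>a\<in>S. \<Sum>b\<in>S. p (a # xs @ [b]) * ?l (a # xs @ [b])) = - H (r + 2)"
    using sum_blocks_snoc[of "\<lambda>xs. p xs * ?l xs" S "Suc r"]
      sum_blocks_Cons[of "\<lambda>xs. \<Sum>b\<in>S. p (xs @ [b]) * ?l (xs @ [b])" S r]
    by (simp add: block_entropy_eq)
  also have "(\<Sum>xs\<in>blocks S r. \<Sum>a\<in>S. \<Sum>b\<in>S. p (a # xs @ [b]) * ?l (a # xs)) = - H (r + 1)"
    \<comment> \<open>The instance is about \<open>(a # xs) @ [b]\<close>, which simplifies to the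
      form \<open>a # xs @ [b]\<close> of the summands.\<close>
    using sum_p_snoc[of "_ # _"]
    by (simp add: block_entropy_eq sum_blocks_Cons flip: sum_distrib_right)
  also have "(\<Sum>xs\<in>blocks S r. \<Sum>a\<in>S. \<Sum>b\<in>S. p (a # xs @ [b]) * ?l xs) = - H r"
    using sum_p_snoc[of "_ # _"]
    by (simp add: block_entropy_eq sum_p_Cons flip: sum_distrib_right)
  also have "(\<Sum>xs\<in>blocks S r. \<Sum>a\<in>S. \<Sum>b\<in>S. p (a # xs @ [b]) * ?l (xs @ [b])) = - H (r + 1)"
  proof -
    have "(\<Sum>xs\<in>blocks S r. \<Sum>a\<in>S. \<Sum>b\<in>S. p (a # xs @ [b]) * ?l (xs @ [b]))
        = (\<Sum>xs\<in>blocks S r. \<Sum>b\<in>S. (\<Sum>a\<in>S. p (a # xs @ [b])) * ?l (xs @ [b]))"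
      \<comment> \<open>Here the first letter is the one to sum out, so its sum has to become the
        inner one.\<close>
      by (subst sum.swap) (simp add: sum_distrib_right)
    also have "\<dots> = (\<Sum>xs\<in>blocks S r. \<Sum>b\<in>S. p (xs @ [b]) * ?l (xs @ [b]))"
      by (intro sum.cong refl) (simp add: sum_p_Cons[OF snoc_blocks])
    also have "\<dots> = - H (r + 1)"
      by (simp add: block_entropy_eq sum_blocks_snoc)
    finally show ?thesis .
  qed
  finally show ?thesis
    by (simp add: predictability_gain_def)
qed

text \<open>\<open>?T\<close> compares the joint law with the one that makes the end letters
  conditionally independent. Both have the same total mass, so \<open>?T\<close> is 0, and it bounds
  the gain from below term by term.\<close>

lemma gain_nonneg: "predictability_gain M S X r \<ge> 0"
proof -
  let ?T = "\<Sum>xs\<in>blocks S r. \<Sum>a\<in>S. \<Sum>b\<in>S. p (a # xs @ [b]) - p (a # xs) * p (xs @ [b]) / p xs"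
  have "?T = 0"
  proof -
    have "(\<Sum>b\<in>S. p (a # xs @ [b]) - p (a # xs) * p (xs @ [b]) / p xs) = 0"
      if "xs \<in> blocks S r" "a \<in> S" for xs a
    proof -
      have "(\<Sum>b\<in>S. p (a # xs @ [b]) - p (a # xs) * p (xs @ [b]) / p xs)
          = p (a # xs) - p (a # xs) * p xs / p xs"
        using sum_p_snoc[of "a # xs"] sum_p_snoc[of xs]
        by (simp add: sum_subtractf flip: sum_distrib_left sum_divide_distrib)
      then show ?thesis
        \<comment> \<open>If \<open>p xs = 0\<close>, then \<open>p (a # xs)\<close> vanishes as
          well, so the division by zero does no harm.\<close>
        using p_Cons_le[OF that] p_nonneg[of "a # xs"] by (cases "p xs = 0") auto
    qed
    then show ?thesis by simp
  qed
  moreover have "?T \<le> predictability_gain M S X r"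
    unfolding gain_eq_mutual_information
  proof (intro sum_mono)
    fix xs a b assume *: "xs \<in> blocks S r" "a \<in> S" "b \<in> S"
    show "p (a # xs @ [b]) - p (a # xs) * p (xs @ [b]) / p xs
      \<le> p (a # xs @ [b]) * ln (p (a # xs @ [b]) * p xs / (p (a # xs) * p (xs @ [b])))"
    proof (cases "p (a # xs @ [b]) = 0")
      case True
      then show ?thesis by (simp add: p_nonneg)
    next
      case False
      then have pos: "p (a # xs @ [b]) > 0"
        using p_nonneg[of "a # xs @ [b]"] by simp
      note pos = pos positive_sub_blocks[OF * pos]
      \<comment> \<open>\<open>q\<close> is the reciprocal of the argument of the logarithm, which
        turns the upper bound \<open>ln q \<le> q - 1\<close> into the lower bound needed.\<close>
      define q where "q = p (a # xs) * p (xs @ [b]) / (p (a # xs @ [b]) * p xs)"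
      have "q > 0"
        using pos by (simp add: q_def)
      then have "p (a # xs @ [b]) * ln q \<le> p (a # xs @ [b]) * (q - 1)"
        using pos ln_le_minus_one by (intro mult_left_mono) auto
      moreover have "ln (p (a # xs @ [b]) * p xs / (p (a # xs) * p (xs @ [b]))) = - ln q"
        using pos by (simp add: q_def ln_div ln_mult)
      moreover have "p (a # xs @ [b]) * q = p (a # xs) * p (xs @ [b]) / p xs"
        using pos by (simp add: q_def)
      ultimately show ?thesis
        by (simp add: algebra_simps)
    qed
  qed
  ultimately show ?thesis by simp
qed

lemma gain_eq_0:
  assumes "depends_on_last M S X m" "m \<ge> 1" "m \<le> r"
  shows "predictability_gain M S X r = 0"
  unfolding gain_eq_mutual_information
proof (intro sum.neutral ballI)
  fix xs a b assume *: "xs \<in> blocks S r" "a \<in> S" "b \<in> S"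
  show "p (a # xs @ [b]) * ln (p (a # xs @ [b]) * p xs / (p (a # xs) * p (xs @ [b]))) = 0"
  proof (cases "p (a # xs @ [b]) = 0")
    case False
    then have pos: "p (a # xs @ [b]) > 0"
      using p_nonneg[of "a # xs @ [b]"] by simp
    note pos = pos positive_sub_blocks[OF * pos]
    have dep: "next_prob M X b ys = next_prob M X b (drop (u - m) ys)"
      if "u \<ge> m" "ys \<in> blocks S u" "p ys > 0" for u ys
      using assms that \<open>b \<in> S\<close> by (auto simp: depends_on_last_def)
    \<comment> \<open>Since \<open>m \<le> r\<close>, the blocks \<open>a # xs\<close> and
      \<open>xs\<close> share their last \<open>m\<close> letters, so both predict \<open>b\<close>
      equally well.\<close>
    have "next_prob M X b (a # xs) = next_prob M X b (drop (Suc r - m) (a # xs))"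
      using * pos assms by (intro dep) (auto simp: Cons_blocks)
    also have "drop (Suc r - m) (a # xs) = drop (r - m) xs"
      using assms by (simp add: Suc_diff_le)
    also have "next_prob M X b \<dots> = next_prob M X b xs"
      using * pos assms by (intro dep[symmetric]) auto
    \<comment> \<open>Cross-multiplied, this says that the argument of the logarithm is 1.\<close>
    finally have "p (a # xs @ [b]) * p xs = p (a # xs) * p (xs @ [b])"
      using pos by (simp add: next_prob_eq field_simps)
    with pos show ?thesis
      by simp
  qed simp
qed

section \<open>The entropy line and its value at \<open>m - 1\<close>\<close>

lemma block_entropy_affine:
  assumes "depends_on_last M S X m" "m \<ge> 1" "m \<le> r"
  shows "H r = (H (m + 1) - H m) * (real r - real m) + H m"
proof -
  \<comment> \<open>Vanishing gain is a recursion of order two, so the induction carries two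
    consecutive values.\<close>
  have "H (m + k) = (H (m + 1) - H m) * real k + H m \<and>
      H (m + Suc k) = (H (m + 1) - H m) * real (Suc k) + H m" for k
  proof (induction k)
    case (Suc k)
    have "H (m + Suc (Suc k)) = 2 * H (m + Suc k) - H (m + k)"
      using gain_eq_0[OF assms(1,2), of "m + k"] by (simp add: predictability_gain_def)
    with Suc.IH show ?case
      by (simp add: algebra_simps)
  qed simp
  from this[of "r - m"] show ?thesis
    using assms by (simp add: of_nat_diff)
qed

lemma entropy_line_eq:
  assumes "depends_on_last M S X m" "m \<ge> 1"
  shows "entropy_line M S X m = (\<lambda>x. (H (m + 1) - H m) * (x - real m) + H m)"
  unfolding entropy_line_def
proof (rule the_equality)
  show "(\<exists>a b. \<forall>x. (H (m + 1) - H m) * (x - real m) + H m = a * x + b) \<and>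
      (\<forall>r\<ge>m. (H (m + 1) - H m) * (real r - real m) + H m = H r)"
  proof (intro conjI exI allI impI)
    show "(H (m + 1) - H m) * (x - real m) + H m
        = (H (m + 1) - H m) * x + (H m - (H (m + 1) - H m) * real m)" for x
      by (simp add: right_diff_distrib)
  qed (rule block_entropy_affine[OF assms, symmetric])
next
  fix h assume h: "(\<exists>a b. \<forall>x. h x = a * x + b) \<and> (\<forall>r\<ge>m. h (real r) = H r)"
  then obtain a b where ab: "\<And>x. h x = a * x + b" by blast
  have h_eq: "h (real r) = H r" if "m \<le> r" for r
    using h that by blast
  \<comment> \<open>Uniqueness: the values at \<open>m\<close> and \<open>m + 1\<close> determine
    slope and intercept.\<close>
  have 1: "a * real m + b = H m"
    unfolding ab[symmetric] by (rule h_eq) simp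
  have "a * real (m + 1) + b = H (m + 1)"
    unfolding ab[symmetric] by (rule h_eq) simp
  with 1 have 2: "H (m + 1) - H m = a"
    by (simp only: of_nat_add distrib_left)
  show "h = (\<lambda>x. (H (m + 1) - H m) * (x - real m) + H m)"
    unfolding 2 using ab 1 by (auto simp: right_diff_distrib)
qed

lemma entropy_line_minus_block_entropy:
  assumes "depends_on_last M S X m" "m \<ge> 1"
  shows "entropy_line M S X m (real (m - 1)) - H (m - 1) = predictability_gain M S X (m - 1)"
  \<comment> \<open>The case split removes the truncated subtraction; both sides are then
    \<open>2 * H m - H (m + 1) - H (m - 1)\<close>.\<close>
  using assms by (cases m) (simp_all add: entropy_line_eq predictability_gain_def)

end

theorem proposition4:
  fixes M :: "'w measure" and S :: "'b set" and X :: "nat \<Rightarrow> 'w \<Rightarrow> 'b" and m :: nat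
  assumes "prob_space M"
    and "finite S"
    and "\<And>t. X t \<in> measurable M (count_space S)"
    and "stationary M S X"
    and "m \<ge> 1"
    and "has_memory M S X m"
  shows "predictability_gain M S X (m - 1) =
           dist (real (m - 1), block_entropy M S X (m - 1))
                (real (m - 1), entropy_line M S X m (real (m - 1)))
       \<and> predictability_gain M S X (m - 1) =
           \<bar>entropy_line M S X m (real (m - 1)) - block_entropy M S X (m - 1)\<bar>"
proof -
  interpret stationary_process M S X
    using assms by (simp add: stationary_process_def stationary_process_axioms_def)
  have "depends_on_last M S X m"
    using assms by (simp add: has_memory_def)
  \<comment> \<open>The signed difference is the gain, whose nonnegativity removes the absolute
    value. The two points share their abscissa, so their distance is this absolute value.\<close>
  from entropy_line_minus_block_entropy[OF this \<open>m \<ge> 1\<close>] gain_nonneg[of "m - 1"]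
  show ?thesis
    by (simp add: dist_Pair_Pair dist_real_def)
qed

end
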